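(* Let $S$ be an ordered semigroup satisfying axioms O1–O6. Then $\mathrm{F}(S)$, with the pointwise order, is a complete distributive lattice (i.e. a complete lattice in which $\wedge$ and $\vee$ distribute over each other). Furthermore, addition is distributive with respect to $\wedge$ and $\vee$: for all $\lambda_1,\lambda_2,\lambda_3\in \mathrm{F}(S)$, $$(\lambda_1\vee \lambda_2)+\lambda_3 =(\lambda_1+\lambda_3)\vee (\lambda_2+\lambda_3),$$ $$(\lambda_1\wedge \lambda_2)+\lambda_3 =(\lambda_1+\lambda_3)\wedge (\lambda_2+\lambda_3).$$
   Context: An ordered semigroup is an abelian monoid with a translation invariant order relation in which $0$ is the smallest element. For $s,t$ in an ordered set, $s\ll t$ means: for every increasing sequence $(t_n)$ (having a supremum) with $t\leq \sup_n t_n$ there is $n_0$ with $s\leq t_{n_0}$. Axioms on an ordered semigroup $S$: O1: every increasing sequence has a supremum. O2: every $s\in S$ is the supremum of a sequence $(s_n)$ with $s_n\ll s_{n+1}$ for all $n$. O3: if $s_i\ll t_i$ for $i=1,2$ then $s_1+s_2\ll t_1+t_2$. O4: if $(s_n),(t_n)$ are increasing then $\sup_n(s_n+t_n)=\sup_n s_n+\sup_n t_n$. O5: if $s'\ll s\leq t$ then there exists $r$ with $s'+r\leq t\leq s+r$. O6: if $s\leq r+t$ then for every $s'\ll s$ there exist $r',t'$ with $s'\leq r'+t'$, $r'\leq r$, $r'\leq s$, $t'\leq t$, $t'\leq s$. A functional on $S$ is a map $\lambda\colon S\to[0,\infty]$ that is additive, order preserving, sends $0$ to $0$, and preserves suprema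 of increasing sequences. $\mathrm{F}(S)$ is the cone of all functionals on $S$, with pointwise addition and pointwise order. *)

theory Defs
  imports
    "HOL-Library.Extended_Nonnegative_Real"
    "HOL-Library.Function_Algebras"
    "HOL-Library.Lub_Glb"
    "HOL-Algebra.Complete_Lattice"
begin

class ordered_semigroup = ordered_comm_monoid_add +
  assumes zero_least: "0 \<le> x"

definition is_seq_sup :: "(nat \<Rightarrow> 'a::order) \<Rightarrow> 'a \<Rightarrow> bool"
  where "is_seq_sup t u \<longleftrightarrow> isLub UNIV (range t) u"

definition way_below :: "'a::order \<Rightarrow> 'a \<Rightarrow> bool"  (infix \<open>\<lless>\<close> 50)
  where "s \<lless> t \<longleftrightarrow>
    (\<forall>x u. incseq x \<longrightarrow> is_seq_sup x u \<longrightarrow> t \<le> u \<longrightarrow> (\<exists>n. s \<le> x n))"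

definition axiom_O1 :: "'a::ordered_semigroup itself \<Rightarrow> bool"
  where "axiom_O1 _ \<longleftrightarrow> (\<forall>s :: nat \<Rightarrow> 'a. incseq s \<longrightarrow> (\<exists>u. is_seq_sup s u))"

definition axiom_O2 :: "'a::ordered_semigroup itself \<Rightarrow> bool"
  where "axiom_O2 _ \<longleftrightarrow>
    (\<forall>s :: 'a. \<exists>x :: nat \<Rightarrow> 'a. (\<forall>n. x n \<lless> x (Suc n)) \<and> is_seq_sup x s)"

definition axiom_O3 :: "'a::ordered_semigroup itself \<Rightarrow> bool"
  where "axiom_O3 _ \<longleftrightarrow>
    (\<forall>s1 s2 t1 t2 :: 'a. s1 \<lless> t1 \<longrightarrow> s2 \<lless> t2 \<longrightarrow> s1 + s2 \<lless> t1 + t2)"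

definition axiom_O4 :: "'a::ordered_semigroup itself \<Rightarrow> bool"
  where "axiom_O4 _ \<longleftrightarrow>
    (\<forall>(s :: nat \<Rightarrow> 'a) t u v. incseq s \<longrightarrow> incseq t \<longrightarrow> is_seq_sup s u \<longrightarrow> is_seq_sup t v \<longrightarrow>
       is_seq_sup (\<lambda>n. s n + t n) (u + v))"

definition axiom_O5 :: "'a::ordered_semigroup itself \<Rightarrow> bool"
  where "axiom_O5 _ \<longleftrightarrow>
    (\<forall>s' s t :: 'a. s' \<lless> s \<longrightarrow> s \<le> t \<longrightarrow> (\<exists>r. s' + r \<le> t \<and> t \<le> s + r))"

definition axiom_O6 :: "'a::ordered_semigroup itself \<Rightarrow> bool"
  where "axiom_O6 _ \<longleftrightarrow>
    (\<forall>s r t :: 'a. s \<le> r + t \<longrightarrow>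
       (\<forall>s'. s' \<lless> s \<longrightarrow>
         (\<exists>r' t'. s' \<le> r' + t' \<and> r' \<le> r \<and> r' \<le> s \<and> t' \<le> t \<and> t' \<le> s)))"

definition is_functional :: "('a::ordered_semigroup \<Rightarrow> ennreal) \<Rightarrow> bool"
  where "is_functional l \<longleftrightarrow>
    (\<forall>s t. l (s + t) = l s + l t) \<and> mono l \<and> l 0 = 0 \<and>
    (\<forall>s u. incseq s \<longrightarrow> is_seq_sup s u \<longrightarrow> l u = (SUP n. l (s n)))"

text \<open>The functionals ordered pointwise, as a partially ordered set whose carrier is a proper
  subset of the function type: joins and meets with respect to this structure are those within
  the set of functionals, and in general differ from the pointwise ones (the pointwise maximum of
  two functionals need not be additive).\<close>

definition functionals :: "('a::ordered_semigroup \<Rightarrow> ennreal) gorder"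
  where "functionals = \<lparr>carrier = {l. is_functional l}, eq = (=), le = (\<le>)\<rparr>"

definition distributive_ops :: "('b, 'c) gorder_scheme \<Rightarrow> bool"
  where "distributive_ops L \<longleftrightarrow>
    (\<forall>x\<in>carrier L. \<forall>y\<in>carrier L. \<forall>z\<in>carrier L.
       x \<sqinter>\<^bsub>L\<^esub> (y \<squnion>\<^bsub>L\<^esub> z) = (x \<sqinter>\<^bsub>L\<^esub> y) \<squnion>\<^bsub>L\<^esub> (x \<sqinter>\<^bsub>L\<^esub> z) \<and>
       x \<squnion>\<^bsub>L\<^esub> (y \<sqinter>\<^bsub>L\<^esub> z) = (x \<squnion>\<^bsub>L\<^esub> y) \<sqinter>\<^bsub>L\<^esub> (x \<squnion>\<^bsub>L\<^esub> z))"

text \<open>Addition of functions is the pointwise one; the functionals are closed under it.\<close>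

lemma is_functional_add:
  assumes "is_functional l" "is_functional m"
  shows "is_functional (l + m)"
proof -
  have "l u + m u = (SUP n. l (s n) + m (s n))" if "incseq s" "is_seq_sup s u" for s u
  proof -
    have "incseq (\<lambda>n. l (s n))" "incseq (\<lambda>n. m (s n))"
      using assms that by (auto simp: is_functional_def mono_def)
    then show ?thesis
      using assms that by (simp add: is_functional_def ennreal_SUP_add)
  qed
  then show ?thesis
    using assms by (auto simp: is_functional_def mono_def ac_simps intro!: add_mono)
qed

end

theory Submission
  imports Defs
begin

text \<open>The functionals form a residuated structure: for functionals \<open>l\<close>, \<open>m\<close> there is a least functional
  \<open>l \ m\<close> with \<open>l \<le> l \ m + m\<close>, given by a Riesz--Kantorovich formula for the positive part of \<open>l - m\<close>.
  Its additivity comes from an approximate Riesz decomposition of multiples of elements of the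
  semigroup, which in turn follows from O5 and O6. O5 gives \<open>l \<or> m = l \ m + m\<close>, so finite joins exist;
  directed suprema are pointwise, hence the lattice is complete. Residuation makes addition
  distribute over meets, and then
  \<open>x \<or> (y \<and> z) = x \ (y \<and> z) + (y \<and> z) = (x \ (y \<and> z) + y) \<and> (x \ (y \<and> z) + z) \<ge> (x \<or> y) \<and> (x \<or> z)\<close>,
  as \<open>x \ y\<close> is antitone in \<open>y\<close>.\<close>

subsection \<open>Multiples and the way-below relation\<close>

primrec nat_mult :: "nat \<Rightarrow> 'a::comm_monoid_add \<Rightarrow> 'a"  (infixr \<open>\<cdot>\<close> 75)
  where
    "0 \<cdot> a = 0"
  | "Suc n \<cdot> a = a + n \<cdot> a"

lemma nat_mult_add_left: "(m + n) \<cdot> a = m \<cdot> a + n \<cdot> a"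
  by (induction m) (simp_all add: ac_simps)

lemma nat_mult_add_right: "n \<cdot> (a + b) = n \<cdot> a + n \<cdot> b"
  by (induction n) (simp_all add: ac_simps)

lemma nat_mult_zero_right [simp]: "n \<cdot> 0 = 0"
  by (induction n) simp_all

lemma nat_mult_assoc: "m \<cdot> n \<cdot> a = (m * n) \<cdot> a"
  by (induction m) (simp_all add: nat_mult_add_left)

lemma nat_mult_mono: "a \<le> b \<Longrightarrow> n \<cdot> a \<le> n \<cdot> (b::'a::ordered_comm_monoid_add)"
  by (induction n) (simp_all add: add_mono)

lemma sum_const_nat_mult: "(\<Sum>i<n. a) = n \<cdot> a"
  by (induction n) (simp_all add: ac_simps)

lemma add_right_increasing: "a \<le> a + (b::'a::ordered_semigroup)"
  using add_left_mono[OF zero_least[of b], of a] by simp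

lemma add_left_increasing: "b \<le> a + (b::'a::ordered_semigroup)"
  using add_right_mono[OF zero_least[of a], of b] by simp

text \<open>Substitute for cancellation: a common summand becomes negligible after passing to multiples.\<close>

lemma cancel_multiple:
  fixes a b c :: "'a::ordered_semigroup"
  assumes "a + c \<le> b + c"
  shows "j \<cdot> a + c \<le> j \<cdot> b + c"
proof (induction j)
  case (Suc j)
  have "Suc j \<cdot> a + c = a + (j \<cdot> a + c)" by (simp add: ac_simps)
  also have "\<dots> \<le> a + (j \<cdot> b + c)" by (rule add_left_mono[OF Suc])
  also have "\<dots> = (a + c) + j \<cdot> b" by (simp add: ac_simps)
  also have "\<dots> \<le> (b + c) + j \<cdot> b" by (rule add_right_mono[OF assms])
  also have "\<dots> = Suc j \<cdot> b + c" by (simp add: ac_simps)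
  finally show ?case .
qed simp

lemma is_seq_supD: "is_seq_sup x u \<Longrightarrow> x n \<le> u"
  by (auto simp: is_seq_sup_def isLub_def leastP_def isUb_def setle_def)

lemma way_belowD: "s \<lless> t \<Longrightarrow> incseq x \<Longrightarrow> is_seq_sup x u \<Longrightarrow> t \<le> u \<Longrightarrow> \<exists>n. s \<le> x n"
  by (auto simp: way_below_def)

lemma way_below_le_trans: "s \<lless> t \<Longrightarrow> t \<le> t' \<Longrightarrow> s \<lless> t'"
  unfolding way_below_def by (meson order_trans)

lemma le_way_below_trans: "s' \<le> s \<Longrightarrow> s \<lless> t \<Longrightarrow> s' \<lless> t"
  unfolding way_below_def by (meson order_trans)

lemma way_below_imp_le: "s \<lless> t \<Longrightarrow> s \<le> t"
  by (drule way_belowD[where x = "\<lambda>_. t" and u = t])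
    (auto simp: is_seq_sup_def isLub_def leastP_def setle_def setge_def isUb_def incseq_def)

lemma zero_way_below: "0 \<lless> (t::'a::ordered_semigroup)"
  by (simp add: way_below_def zero_least)

section \<open>Semigroups satisfying O2 to O6, and approximation from below\<close>

locale Cu_semigroup =
  fixes S :: "'a::ordered_semigroup itself"
  assumes O2: "axiom_O2 TYPE('a)"
    and O3: "axiom_O3 TYPE('a)"
    and O4: "axiom_O4 TYPE('a)"
    and O5: "axiom_O5 TYPE('a)"
    and O6: "axiom_O6 TYPE('a)"
begin

lemma approximating_sequence:
  fixes s :: 'a
  obtains x where "\<And>n. x n \<lless> x (Suc n)" "incseq x" "is_seq_sup x s" "\<And>n. x n \<lless> s"
proof -
  obtain x where x: "\<And>n. x n \<lless> x (Suc n)" "is_seq_sup x s"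
    using O2 unfolding axiom_O2_def by blast
  show thesis
    by (rule that[OF x(1) _ x(2)])
      (auto intro: incseq_SucI way_below_imp_le x way_below_le_trans[OF x(1) is_seq_supD[OF x(2)]])
qed

text \<open>In a rapidly increasing sequence with supremum \<open>t\<close>, some term dominates
  \<open>s\<close>; the next term then serves as \<open>r\<close>.\<close>

lemma way_below_interpolate:
  fixes s t :: 'a
  assumes "s \<lless> t"
  obtains r where "s \<lless> r" "r \<lless> t"
proof -
  obtain x where x: "\<And>n. x n \<lless> x (Suc n)" "incseq x" "is_seq_sup x t" "\<And>n. x n \<lless> t"
    using approximating_sequence[of t] by blast
  obtain n where "s \<le> x n"
    using way_belowD[OF assms x(2,3)] by blast
  with x that show thesis
    using le_way_below_trans by blast
qed

lemma way_below_add: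
  fixes s1 s2 t1 t2 :: 'a
  shows "s1 \<lless> t1 \<Longrightarrow> s2 \<lless> t2 \<Longrightarrow> s1 + s2 \<lless> t1 + t2"
  using O3 by (auto simp: axiom_O3_def)

lemma way_below_nat_mult:
  fixes s t :: 'a
  shows "s \<lless> t \<Longrightarrow> n \<cdot> s \<lless> n \<cdot> t"
  by (induction n) (auto intro: way_below_add zero_way_below)

lemma way_below_sum:
  fixes x y :: "nat \<Rightarrow> 'a"
  shows "(\<And>i. x i \<lless> y i) \<Longrightarrow> (\<Sum>i<n. x i) \<lless> (\<Sum>i<n. y i)"
  by (induction n) (auto intro: way_below_add zero_way_below)

text \<open>By O4 the termwise sums of approximating sequences of \<open>s\<close> and
  \<open>t\<close> increase to \<open>s + t\<close>, so one of them dominates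
  \<open>w\<close>.\<close>

lemma way_below_add_split:
  fixes w s t :: 'a
  assumes "w \<lless> s + t"
  obtains s' t' where "s' \<lless> s" "t' \<lless> t" "w \<le> s' + t'"
proof -
  obtain x where x: "incseq x" "is_seq_sup x s" "\<And>n. x n \<lless> s"
    using approximating_sequence[of s] by blast
  obtain y where y: "incseq y" "is_seq_sup y t" "\<And>n. y n \<lless> t"
    using approximating_sequence[of t] by blast
  have "is_seq_sup (\<lambda>n. x n + y n) (s + t)" "incseq (\<lambda>n. x n + y n)"
    using O4 x y by (auto simp: axiom_O4_def incseq_def intro: add_mono)
  then obtain n where "w \<le> x n + y n"
    using way_belowD[OF assms] by blast
  with x y that show thesis by blast
qed

text \<open>The averages of a chain between \<open>a'\<close> and \<open>a\<close>, and of its shift by one place, differ by at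
  most \<open>a / n\<close>: this makes approximate complements and differences available.\<close>

lemma averaged_chain:
  fixes a' a :: 'a
  assumes "a' \<lless> a"
  obtains b c where "n \<cdot> a' \<le> b" "b \<lless> c" "c \<le> n \<cdot> a" "c \<le> b + a"
proof -
  obtain x where x: "\<And>n. x n \<lless> x (Suc n)" "incseq x" "is_seq_sup x a"
    using approximating_sequence[of a] by blast
  obtain k where k: "a' \<le> x k"
    using way_belowD[OF assms x(2,3)] by blast
  define b where "b = (\<Sum>i<n. x (k + i))"
  define c where "c = (\<Sum>i<n. x (Suc (k + i)))"
  show thesis
  proof (rule that)
    have "(\<Sum>i<n. a') \<le> b"
      unfolding b_def by (intro sum_mono order_trans[OF k] incseqD[OF x(2)]) simp
    then show "n \<cdot> a' \<le> b" by (simp add: sum_const_nat_mult)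
    show "b \<lless> c"
      unfolding b_def c_def by (intro way_below_sum x)
    have "c \<le> (\<Sum>i<n. a)"
      unfolding c_def by (intro sum_mono is_seq_supD x)
    then show "c \<le> n \<cdot> a" by (simp add: sum_const_nat_mult)
    \<comment> \<open>Putting back the first term of the unshifted chain gives \<open>n + 1\<close>
      consecutive terms, the last of which is at most \<open>a\<close>.\<close>
    have "c \<le> x k + c" by (rule add_left_increasing)
    also have "\<dots> = (\<Sum>i<Suc n. x (k + i))"
      unfolding c_def by (subst sum.lessThan_Suc_shift) simp
    also have "\<dots> \<le> b + a"
      unfolding b_def using is_seq_supD[OF x(3)] by (simp add: add_left_mono)
    finally show "c \<le> b + a" .
  qed
qed

section \<open>Approximate complements and Riesz decomposition\<close>

lemma complementE:
  fixes s' s t :: 'a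
  assumes "s' \<lless> s" "s \<le> t"
  obtains r where "s' + r \<le> t" "t \<le> s + r"
  using assms O5 unfolding axiom_O5_def by blast

text \<open>O5 bounds a complement from its two sides by different elements. For the averages
  \<open>b\<close> and \<open>c\<close> these differ by at most \<open>a\<close>, so the error is a
  single copy of \<open>a\<close>, whatever \<open>n\<close> is.\<close>

lemma approximate_complement:
  fixes a' a s :: 'a
  assumes "a' \<lless> a" "a \<le> s"
  obtains x d where "n \<cdot> a' \<le> x" "x \<le> n \<cdot> a" "x + d \<le> n \<cdot> s" "n \<cdot> s \<le> (x + a) + d"
proof -
  obtain b c where bc: "n \<cdot> a' \<le> b" "b \<lless> c" "c \<le> n \<cdot> a" "c \<le> b + a"
    by (rule averaged_chain[OF assms(1)])
  have "c \<le> n \<cdot> s" using bc(3) nat_mult_mono[OF assms(2)] by (rule order_trans)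
  then obtain d where d: "b + d \<le> n \<cdot> s" "n \<cdot> s \<le> c + d"
    using complementE[OF bc(2)] by blast
  have "b \<le> n \<cdot> a" using way_below_imp_le[OF bc(2)] bc(3) by (rule order_trans)
  moreover have "n \<cdot> s \<le> (b + a) + d"
    using d(2) add_right_mono[OF bc(4)] by (rule order_trans)
  ultimately show thesis using that bc(1) d(1) by blast
qed

lemma weak_decomposition:
  fixes s' s r t :: 'a
  assumes "s' \<lless> s" "s \<le> r + t"
  obtains r' t' where "s' \<le> r' + t'" "r' \<le> r" "r' \<le> s" "t' \<le> t" "t' \<le> s"
  using assms O6 unfolding axiom_O6_def by blast

text \<open>The error of \<open>3 * m\<^sup>2\<close> copies of \<open>r\<close> is small against
  \<open>m ^ 3\<close> copies when \<open>m\<close> is large. O6 bounds two summands separately but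
  not their sum; so one is replaced by an approximate complement of the other, and cancellation with
  a second use of O6 brings this complement below a multiple of \<open>t\<close>.\<close>

lemma approximate_Riesz_decomposition:
  fixes r' r s t :: 'a
  assumes "r' \<lless> r" "r \<le> s + t"
  obtains x y where "m ^ 3 \<cdot> r' \<le> (x + y) + (3 * m\<^sup>2) \<cdot> r" "x + y \<le> m ^ 3 \<cdot> r"
    "x \<le> m ^ 3 \<cdot> s" "y \<le> m ^ 3 \<cdot> t"
proof -
  have pow: "m * m = m\<^sup>2" "m * m\<^sup>2 = m ^ 3" "m\<^sup>2 * m = m ^ 3"
    by (simp_all add: power2_eq_square power3_eq_cube)
  obtain R0 R1 where R: "m \<cdot> r' \<le> R0" "R0 \<lless> R1" "R1 \<le> m \<cdot> r" "R1 \<le> R0 + r"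
    by (rule averaged_chain[OF assms(1)])
  \<comment> \<open>Room on both sides: O6 uses \<open>R\<close> way below \<open>R1\<close>, and
    \<open>R0\<close> way below \<open>R\<close> later permits shrinking \<open>a\<close> to
    \<open>a'\<close>.\<close>
  obtain R where R': "R0 \<lless> R" "R \<lless> R1"
    by (rule way_below_interpolate[OF R(2)])
  have "R1 \<le> m \<cdot> s + m \<cdot> t"
    using order_trans[OF R(3) nat_mult_mono[OF assms(2)]] by (simp add: nat_mult_add_right)
  then obtain a b where ab: "R \<le> a + b" "a \<le> m \<cdot> s" "a \<le> R1" "b \<le> m \<cdot> t"
    using weak_decomposition[OF R'(2)] by blast
  obtain a' b' where a'b': "a' \<lless> a" "b' \<lless> b" "R0 \<le> a' + b'"
    by (rule way_below_add_split[OF way_below_le_trans[OF R'(1) ab(1)]])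
  have R0: "R0 \<le> a' + b"
    using a'b'(3) add_left_mono[OF way_below_imp_le[OF a'b'(2)]] by (rule order_trans)
  \<comment> \<open>Here \<open>x\<close> stands for \<open>m\<close> copies of \<open>a\<close>,
    and \<open>d\<close> for the rest of \<open>m \<cdot> R1\<close>; unlike \<open>a + b\<close>,
    the sum \<open>x + d\<close> is bounded from above.\<close>
  obtain x d where xd: "m \<cdot> a' \<le> x" "x \<le> m \<cdot> a" "x + d \<le> m \<cdot> R1" "m \<cdot> R1 \<le> (x + a) + d"
    by (rule approximate_complement[OF a'b'(1) ab(3)])
  have aR: "a \<le> m \<cdot> r" using ab(3) R(3) by (rule order_trans)
  have xr: "x \<le> m\<^sup>2 \<cdot> r"
    using order_trans[OF xd(2) nat_mult_mono[OF aR]] by (simp add: nat_mult_assoc pow)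
  \<comment> \<open>Comparing \<open>d + x\<close> with the decomposition
    \<open>R0 \<le> a' + b\<close> and cancelling \<open>x\<close> bounds \<open>d\<close> by
    \<open>b\<close>. The copy of \<open>x\<close> that survives the cancellation is absorbed by
    \<open>m\<^sup>2 \<cdot> r\<close>.\<close>
  have "d + x \<le> m \<cdot> (R0 + r)"
    using order_trans[OF xd(3) nat_mult_mono[OF R(4)]] by (simp add: ac_simps)
  also have "\<dots> \<le> m \<cdot> (a' + b + r)"
    by (intro nat_mult_mono add_right_mono R0)
  also have "\<dots> = m \<cdot> a' + m \<cdot> (b + r)"
    by (simp add: nat_mult_add_right add.assoc)
  also have "\<dots> \<le> m \<cdot> (b + r) + x"
    using add_right_mono[OF xd(1), of "m \<cdot> (b + r)"] by (simp only: ac_simps)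
  finally have "m \<cdot> d + x \<le> m \<cdot> m \<cdot> (b + r) + x"
    by (rule cancel_multiple)
  then have "m \<cdot> d \<le> m \<cdot> m \<cdot> (b + r) + x"
    using add_right_increasing order_trans by blast
  also have "\<dots> \<le> m \<cdot> m \<cdot> (b + r) + m\<^sup>2 \<cdot> r"
    by (rule add_left_mono[OF xr])
  also have "\<dots> = m\<^sup>2 \<cdot> b + (2 * m\<^sup>2) \<cdot> r"
    by (simp add: nat_mult_assoc pow nat_mult_add_right nat_mult_add_left mult_2 ac_simps)
  finally have d: "m \<cdot> d \<le> m\<^sup>2 \<cdot> b + (2 * m\<^sup>2) \<cdot> r" .
  obtain xa d' where d': "xa \<lless> x + a" "d' \<lless> d" "m \<cdot> R0 \<le> xa + d'"
    by (rule way_below_add_split[OF way_below_le_trans[OF way_below_nat_mult[OF R(2)] xd(4)]])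
  have R0': "m \<cdot> R0 \<le> (x + a) + d'"
    using d'(3) add_right_mono[OF way_below_imp_le[OF d'(1)]] by (rule order_trans)
  \<comment> \<open>O6 splits the error \<open>e\<close> off, leaving a part \<open>y\<close> below
    a multiple of \<open>b\<close>, hence of \<open>t\<close>, and still below
    \<open>m \<cdot> d\<close>.\<close>
  obtain y e where ye: "m \<cdot> d' \<le> y + e" "y \<le> m\<^sup>2 \<cdot> b" "y \<le> m \<cdot> d" "e \<le> (2 * m\<^sup>2) \<cdot> r"
    using weak_decomposition[OF way_below_nat_mult[OF d'(2)] d] by blast
  show thesis
  proof (rule that)
    have "m ^ 3 \<cdot> r' = m\<^sup>2 \<cdot> m \<cdot> r'"
      by (simp add: nat_mult_assoc pow)
    also have "\<dots> \<le> m\<^sup>2 \<cdot> R0"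
      by (rule nat_mult_mono[OF R(1)])
    also have "\<dots> = m \<cdot> m \<cdot> R0"
      by (simp add: nat_mult_assoc pow)
    also have "\<dots> \<le> m \<cdot> ((x + a) + d')"
      by (rule nat_mult_mono[OF R0'])
    also have "\<dots> = (m \<cdot> x + m \<cdot> a) + m \<cdot> d'"
      by (simp add: nat_mult_add_right)
    also have "\<dots> \<le> (m \<cdot> x + m\<^sup>2 \<cdot> r) + (y + (2 * m\<^sup>2) \<cdot> r)"
      using nat_mult_mono[OF aR, of m] ye(1) add_left_mono[OF ye(4), of y]
      by (intro add_mono) (auto simp: nat_mult_assoc pow intro: order_trans)
    also have "\<dots> = (m \<cdot> x + y) + (m\<^sup>2 + 2 * m\<^sup>2) \<cdot> r"
      by (simp only: nat_mult_add_left ac_simps)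
    also have "m\<^sup>2 + 2 * m\<^sup>2 = 3 * m\<^sup>2"
      by simp
    finally show "m ^ 3 \<cdot> r' \<le> (m \<cdot> x + y) + (3 * m\<^sup>2) \<cdot> r" .
    have "m \<cdot> x + y \<le> m \<cdot> (x + d)"
      unfolding nat_mult_add_right by (rule add_left_mono[OF ye(3)])
    also have "\<dots> \<le> m \<cdot> m \<cdot> m \<cdot> r"
      using order_trans[OF xd(3) nat_mult_mono[OF R(3)]] by (rule nat_mult_mono)
    finally show "m \<cdot> x + y \<le> m ^ 3 \<cdot> r"
      by (simp add: nat_mult_assoc pow)
    have "m \<cdot> x \<le> m \<cdot> m \<cdot> m \<cdot> s"
      using order_trans[OF xd(2) nat_mult_mono[OF ab(2)]] by (rule nat_mult_mono)
    then show "m \<cdot> x \<le> m ^ 3 \<cdot> s"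
      by (simp add: nat_mult_assoc pow)
    show "y \<le> m ^ 3 \<cdot> t"
      using order_trans[OF ye(2) nat_mult_mono[OF ab(4)]] by (simp add: nat_mult_assoc pow)
  qed
qed

end

subsection \<open>Functionals\<close>

lemma functional_add: "is_functional l \<Longrightarrow> l (s + t) = l s + l t"
  by (simp add: is_functional_def)

lemma functional_mono: "is_functional l \<Longrightarrow> s \<le> t \<Longrightarrow> l s \<le> l t"
  by (auto simp: is_functional_def mono_def)

lemma functional_zero: "is_functional l \<Longrightarrow> l 0 = 0"
  by (simp add: is_functional_def)

lemma functional_seq_sup: "is_functional l \<Longrightarrow> incseq x \<Longrightarrow> is_seq_sup x u \<Longrightarrow> l u = (SUP n. l (x n))"
  by (simp add: is_functional_def)

lemma functional_nat_mult:
  assumes "is_functional l"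
  shows "l (n \<cdot> a) = of_nat n * l a"
  by (induction n) (simp_all add: functional_zero[OF assms] functional_add[OF assms] distrib_right)

lemma is_functional_0: "is_functional 0"
  by (auto simp: is_functional_def mono_def zero_fun_def)

text \<open>Directedness makes the supremum of the sums split into a sum of suprema; preservation of
  increasing suprema is an interchange of two suprema.\<close>

lemma is_functional_directed_SUP:
  fixes f :: "'i \<Rightarrow> 'a::ordered_semigroup \<Rightarrow> ennreal"
  assumes f: "\<And>i. i \<in> I \<Longrightarrow> is_functional (f i)" and "I \<noteq> {}"
    and directed: "\<And>i j. i \<in> I \<Longrightarrow> j \<in> I \<Longrightarrow> \<exists>k\<in>I. f i \<le> f k \<and> f j \<le> f k"
  shows "is_functional (\<lambda>s. SUP i\<in>I. f i s)"
  unfolding is_functional_def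
proof (intro conjI allI impI)
  fix s t
  have "(SUP i\<in>I. f i (s + t)) = (SUP i\<in>I. f i s + f i t)"
    by (intro SUP_cong refl functional_add f)
  also have "\<dots> = (SUP i\<in>I. f i s) + (SUP i\<in>I. f i t)"
  proof (rule SUP_add_directed_ennreal)
    fix i j assume "i \<in> I" "j \<in> I"
    then obtain k where "k \<in> I" "f i \<le> f k" "f j \<le> f k"
      using directed by blast
    then show "\<exists>k\<in>I. f i s + f j t \<le> f k s + f k t"
      by (auto simp: le_fun_def intro: add_mono)
  qed
  finally show "(SUP i\<in>I. f i (s + t)) = (SUP i\<in>I. f i s) + (SUP i\<in>I. f i t)" .
next
  show "mono (\<lambda>s. SUP i\<in>I. f i s)"
    by (intro monoI SUP_mono) (blast intro: functional_mono[OF f])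
next
  show "(SUP i\<in>I. f i 0) = 0"
    using \<open>I \<noteq> {}\<close> by (simp add: functional_zero[OF f])
next
  fix x :: "nat \<Rightarrow> 'a" and u assume x: "incseq x" "is_seq_sup x u"
  have "(SUP i\<in>I. f i u) = (SUP i\<in>I. SUP n. f i (x n))"
    by (intro SUP_cong refl functional_seq_sup[OF f] x)
  also have "\<dots> = (SUP n. SUP i\<in>I. f i (x n))"
    by (rule SUP_commute)
  finally show "(SUP i\<in>I. f i u) = (SUP n. SUP i\<in>I. f i (x n))" .
qed

text \<open>Archimedean argument: after division by \<open>m\<close> the finite error
  \<open>z\<close> vanishes in the limit. This removes the error term of the approximate Riesz
  decomposition.\<close>

lemma ennreal_le_of_multiples:
  fixes x y z :: ennreal
  assumes "\<And>m. m > 0 \<Longrightarrow> of_nat m * x \<le> of_nat m * y + z" and "z < \<infinity>"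
  shows "x \<le> y"
proof (cases "x = \<infinity>")
  case True
  then show ?thesis
    using assms(1)[of 1] \<open>z < \<infinity>\<close> by (auto simp: top_unique)
next
  case False
  show ?thesis
  proof (cases "y = \<infinity>")
    case False
    obtain a where a: "x = ennreal a" "a \<ge> 0" using \<open>x \<noteq> \<infinity>\<close> by (cases x) auto
    obtain b where b: "y = ennreal b" "b \<ge> 0" using \<open>y \<noteq> \<infinity>\<close> by (cases y) auto
    obtain c where c: "z = ennreal c" "c \<ge> 0" using \<open>z < \<infinity>\<close> by (cases z) auto
    have *: "real m * a \<le> real m * b + c" if "m > 0" for m
      using assms(1)[OF that] a b c
      by (simp add: ennreal_of_nat_eq_real_of_nat flip: ennreal_mult ennreal_plus)
    have "a \<le> b"
    proof (rule ccontr)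
      assume "\<not> a \<le> b"
      then obtain m where m: "c < real m * (a - b)"
        using reals_Archimedean3[of "a - b"] by auto
      moreover from this c have "m > 0" by (cases m) auto
      ultimately show False
        using *[of m] by (simp add: algebra_simps)
    qed
    with a b show ?thesis by (simp add: ennreal_leI)
  qed simp
qed

lemma ennreal_of_nat_mult_le_cancel:
  fixes x y :: ennreal
  shows "n > 0 \<Longrightarrow> of_nat n * x \<le> of_nat n * y \<longleftrightarrow> x \<le> y"
  by (rule ennreal_mult_le_mult_iff) auto

section \<open>Functionals and approximation from below\<close>

context Cu_semigroup
begin

text \<open>A functional is determined by its values way below \<open>s\<close>. The constant
  \<open>k\<close> allows a further summand where subtraction would be awkward.\<close>

lemma functional_le_if_way_below:
  fixes l :: "'a \<Rightarrow> ennreal"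
  assumes l: "is_functional l" and le: "\<And>w. w \<lless> s \<Longrightarrow> l w + k \<le> c"
  shows "l s + k \<le> c"
proof -
  obtain x where x: "incseq x" "is_seq_sup x s" "\<And>n. x n \<lless> s"
    using approximating_sequence[of s] by blast
  have "l s + k = (SUP n. l (x n) + k)"
    by (simp add: functional_seq_sup[OF l x(1,2)] ennreal_SUP_add_left)
  also have "\<dots> \<le> c"
    by (intro SUP_least le x)
  finally show ?thesis .
qed

text \<open>Additivity survives because elements way below \<open>s + t\<close> split and those way
  below \<open>s\<close> and \<open>t\<close> add up. Interpolation supplies preservation of
  increasing suprema, which \<open>g\<close> itself is not assumed to have.\<close>

lemma is_functional_regularization:
  fixes g :: "'a \<Rightarrow> ennreal"
  assumes add: "\<And>s t. g (s + t) = g s + g t" and mono: "mono g" and "g 0 = 0"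
  shows "is_functional (\<lambda>s. SUP w\<in>{w. w \<lless> s}. g w)" (is "is_functional ?G")
  unfolding is_functional_def
proof (intro conjI allI impI)
  fix s t :: 'a
  show "?G (s + t) = ?G s + ?G t"
  proof (rule antisym)
    show "?G (s + t) \<le> ?G s + ?G t"
    proof (rule SUP_least)
      fix w assume "w \<in> {w. w \<lless> s + t}"
      then obtain s' t' where w: "s' \<lless> s" "t' \<lless> t" "w \<le> s' + t'"
        using way_below_add_split by blast
      have "g w \<le> g s' + g t'"
        using monoD[OF mono w(3)] by (simp add: add)
      also have "\<dots> \<le> ?G s + ?G t"
        using w by (intro add_mono SUP_upper) auto
      finally show "g w \<le> ?G s + ?G t" .
    qed
    have ne: "{w. w \<lless> r} \<noteq> {}" for r :: 'a
      using zero_way_below by blast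
    have "?G s + ?G t = (SUP v\<in>{w. w \<lless> s}. SUP w\<in>{w. w \<lless> t}. g v + g w)"
      by (simp only: ennreal_SUP_add_right[OF ne, symmetric] ennreal_SUP_add_left[OF ne])
    also have "\<dots> \<le> ?G (s + t)"
      by (intro SUP_least) (auto simp: add[symmetric] intro!: SUP_upper way_below_add)
    finally show "?G s + ?G t \<le> ?G (s + t)" .
  qed
next
  show "mono ?G"
    by (intro monoI SUP_subset_mono) (auto intro: way_below_le_trans)
next
  have "?G 0 \<le> g 0"
    by (intro SUP_least monoD[OF mono]) (auto dest: way_below_imp_le)
  then show "?G 0 = 0"
    using \<open>g 0 = 0\<close> by simp
next
  fix x :: "nat \<Rightarrow> 'a" and u assume x: "incseq x" "is_seq_sup x u"
  show "?G u = (SUP n. ?G (x n))"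
  proof (rule antisym)
    show "?G u \<le> (SUP n. ?G (x n))"
    proof (rule SUP_least)
      fix w assume "w \<in> {w. w \<lless> u}"
      then obtain v where v: "w \<lless> v" "v \<lless> u"
        using way_below_interpolate by blast
      obtain n where "v \<le> x n"
        using way_belowD[OF v(2) x] by blast
      then have "w \<lless> x n"
        by (rule way_below_le_trans[OF v(1)])
      then have "g w \<le> ?G (x n)"
        by (intro SUP_upper) simp
      also have "\<dots> \<le> (SUP n. ?G (x n))"
        by (rule SUP_upper) simp
      finally show "g w \<le> (SUP n. ?G (x n))" .
    qed
    show "(SUP n. ?G (x n)) \<le> ?G u"
      by (intro SUP_least SUP_subset_mono)
        (auto intro: way_below_le_trans is_seq_supD[OF x(2)])
  qed
qed

end

subsection \<open>Residuals\<close>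

text \<open>The Riesz--Kantorovich formula for the positive part of \<open>l - m\<close>. Multiples of \<open>s\<close> are admitted
  since the Riesz decomposition holds only after passing to multiples.\<close>

definition excess :: "('a::ordered_semigroup \<Rightarrow> ennreal) \<Rightarrow> ('a \<Rightarrow> ennreal) \<Rightarrow> 'a \<Rightarrow> ennreal"
  where "excess l m s =
    Sup {c. \<exists>n a. n > 0 \<and> a \<le> n \<cdot> s \<and> m a < \<infinity> \<and> of_nat n * c + m a \<le> l a}"

text \<open>The regularization of the additive map \<open>excess l m\<close>, taken so that
  increasing suprema are preserved.\<close>

definition residual :: "('a::ordered_semigroup \<Rightarrow> ennreal) \<Rightarrow> ('a \<Rightarrow> ennreal) \<Rightarrow> 'a \<Rightarrow> ennreal"
  where "residual l m s = (SUP w\<in>{w. w \<lless> s}. excess l m w)"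

lemma excess_upper:
  "n > 0 \<Longrightarrow> a \<le> n \<cdot> s \<Longrightarrow> m a < \<infinity> \<Longrightarrow> of_nat n * c + m a \<le> l a \<Longrightarrow> c \<le> excess l m s"
  unfolding excess_def by (intro Sup_upper) blast

text \<open>Finiteness of \<open>m a\<close> allows it to be cancelled, so upper bounds can be
  tested without subtraction.\<close>

lemma excess_least:
  assumes "\<And>n a. n > 0 \<Longrightarrow> a \<le> n \<cdot> s \<Longrightarrow> m a < \<infinity> \<Longrightarrow> l a \<le> of_nat n * C + m a"
  shows "excess l m s \<le> C"
  unfolding excess_def
proof (rule Sup_least)
  fix c assume "c \<in> {c. \<exists>n a. n > 0 \<and> a \<le> n \<cdot> s \<and> m a < \<infinity> \<and> of_nat n * c + m a \<le> l a}"
  then obtain n a where a: "n > 0" "a \<le> n \<cdot> s" "m a < \<infinity>" "of_nat n * c + m a \<le> l a"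
    by blast
  have "of_nat n * c + m a \<le> of_nat n * C + m a"
    using a(4) assms[OF a(1-3)] by (rule order_trans)
  then have "of_nat n * c \<le> of_nat n * C"
    using a(3) by auto
  then show "c \<le> C"
    by (rule ennreal_of_nat_mult_le_cancel[OF a(1), THEN iffD1])
qed

text \<open>If \<open>m a \<le> l a\<close>, then \<open>(l a - m a) / of_nat n\<close> is an
  admissible \<open>c\<close>. With \<open>excess_least\<close> this makes the excess the least
  constant satisfying all these inequalities.\<close>

lemma le_excess:
  assumes "n > 0" "a \<le> n \<cdot> s" "m a < \<infinity>"
  shows "l a \<le> of_nat n * excess l m s + m a"
proof (cases "m a \<le> l a")
  case True
  have n: "of_nat n * (x / of_nat n) = x" for x :: ennreal
    unfolding ennreal_times_divide mult.commute[of "of_nat n" x]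
    using \<open>n > 0\<close> by (intro ennreal_mult_divide_eq) auto
  have "(l a - m a) / of_nat n \<le> excess l m s"
    using assms
    by (intro excess_upper[where m = m and n = n and a = a]) (simp_all only: n diff_add_cancel_ennreal[OF True] order_refl)
  then have "of_nat n * ((l a - m a) / of_nat n) \<le> of_nat n * excess l m s"
    by (rule mult_left_mono) simp
  then have "l a - m a + m a \<le> of_nat n * excess l m s + m a"
    unfolding n by (rule add_right_mono)
  then show ?thesis
    by (simp add: diff_add_cancel_ennreal True)
next
  case False
  have "m a \<le> of_nat n * excess l m s + m a"
    by (simp add: add_increasing)
  with False show ?thesis by (meson linear order_trans)
qed

lemma excess_mono:
  assumes "s \<le> t"
  shows "excess l m s \<le> excess l m t"
  by (rule excess_least) (blast intro: le_excess order_trans nat_mult_mono[OF assms])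

lemma excess_zero:
  assumes "is_functional l"
  shows "excess l m 0 = 0"
proof -
  have "excess l m 0 \<le> 0"
  proof (rule excess_least)
    fix n a assume "a \<le> n \<cdot> (0::'a)"
    then have "l a \<le> l 0"
      using functional_mono[OF assms] by simp
    then show "l a \<le> of_nat n * 0 + m a"
      by (simp add: functional_zero[OF assms])
  qed
  then show ?thesis by simp
qed

text \<open>If \<open>a\<close> with \<open>n\<close> copies of \<open>s\<close> admits
  \<open>c\<close>, and \<open>b\<close> with \<open>k\<close> copies of \<open>t\<close> admits
  \<open>d\<close>, then \<open>k \<cdot> a + n \<cdot> b\<close> with \<open>n * k\<close> copies
  of \<open>s + t\<close> admits \<open>c + d\<close>.\<close>

lemma excess_add_excess_le:
  assumes l: "is_functional l" and m: "is_functional m"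
  shows "excess l m s + excess l m t \<le> excess l m (s + t)"
proof -
  let ?X = "\<lambda>s. {c. \<exists>n a. n > 0 \<and> a \<le> n \<cdot> s \<and> m a < \<infinity> \<and> of_nat n * c + m a \<le> l a}"
  have ne: "?X s \<noteq> {}" for s
  proof -
    have "0 \<in> ?X s"
      by (intro CollectI exI[of _ "1::nat"] exI[of _ "0::'a"])
        (simp add: functional_zero[OF l] functional_zero[OF m] zero_least)
    then show ?thesis by blast
  qed
  have "c + d \<le> excess l m (s + t)" if cd: "c \<in> ?X s" "d \<in> ?X t" for c d
  proof -
    obtain n a where a: "n > 0" "a \<le> n \<cdot> s" "m a < \<infinity>" "of_nat n * c + m a \<le> l a"
      using cd(1) by blast
    obtain k b where b: "k > 0" "b \<le> k \<cdot> t" "m b < \<infinity>" "of_nat k * d + m b \<le> l b"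
      using cd(2) by blast
    show ?thesis
    proof (rule excess_upper[where n = "n * k" and a = "k \<cdot> a + n \<cdot> b"])
      show "n * k > 0" using a b by simp
      show "k \<cdot> a + n \<cdot> b \<le> (n * k) \<cdot> (s + t)"
        using add_mono[OF nat_mult_mono[OF a(2), of k] nat_mult_mono[OF b(2), of n]]
        by (simp add: nat_mult_add_right nat_mult_assoc mult.commute)
      show "m (k \<cdot> a + n \<cdot> b) < \<infinity>"
        using a b by (simp add: functional_add[OF m] functional_nat_mult[OF m] ennreal_mult_less_top of_nat_less_top power_less_top_ennreal)
      have "of_nat (n * k) * (c + d) + m (k \<cdot> a + n \<cdot> b)
          = of_nat k * (of_nat n * c + m a) + of_nat n * (of_nat k * d + m b)"
        by (simp add: functional_add[OF m] functional_nat_mult[OF m] algebra_simps)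
      also have "\<dots> \<le> of_nat k * l a + of_nat n * l b"
        by (intro add_mono mult_left_mono a b) auto
      finally show "of_nat (n * k) * (c + d) + m (k \<cdot> a + n \<cdot> b) \<le> l (k \<cdot> a + n \<cdot> b)"
        by (simp add: functional_add[OF l] functional_nat_mult[OF l])
    qed
  qed
  then have "(SUP c\<in>?X s. SUP d\<in>?X t. c + d) \<le> excess l m (s + t)"
    by (intro SUP_least)
  moreover have "(SUP c\<in>?X s. SUP d\<in>?X t. c + d) = (SUP c\<in>?X s. c) + (SUP d\<in>?X t. d)"
    by (simp only: ennreal_SUP_add_right[OF ne, symmetric] ennreal_SUP_add_left[OF ne])
  ultimately show ?thesis
    unfolding excess_def by simp
qed

section \<open>Additivity of the excess\<close>

context Cu_semigroup
begin

text \<open>An element below \<open>n \<cdot> (s + t)\<close> is split approximately into parts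
  below multiples of \<open>s\<close> and \<open>t\<close>, and \<open>le_excess\<close> is applied
  to each part.\<close>

lemma excess_add_le:
  fixes l m :: "'a \<Rightarrow> ennreal"
  assumes l: "is_functional l" and m: "is_functional m"
  shows "excess l m (s + t) \<le> excess l m s + excess l m t"
proof (rule excess_least)
  fix n r assume n: "n > 0" and r: "r \<le> n \<cdot> (s + t)" and mr: "m r < \<infinity>"
  let ?C = "excess l m s + excess l m t"
  have finite_below: "m w < \<infinity>" if "w \<le> r" for w
    using functional_mono[OF m that] mr by (rule order.strict_trans1)
  have r': "r \<le> n \<cdot> s + n \<cdot> t"
    using r by (simp add: nat_mult_add_right)
  have "l w + 0 \<le> of_nat n * ?C + m r" if wr: "w \<lless> r" for w
  proof -
    \<comment> \<open>The decomposition error is measured by \<open>l q\<close>, so the cases of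
      finite and infinite \<open>l q\<close> are separated.\<close>
    obtain q where q: "w \<lless> q" "q \<lless> r"
      using way_below_interpolate[OF wr] by blast
    show ?thesis
    proof (cases "l q < \<infinity>")
      case True
      have "l w \<le> of_nat n * ?C + m r"
      proof (rule ennreal_le_of_multiples)
        show "3 * l q < \<infinity>"
          using True by (simp add: ennreal_mult_less_top of_nat_less_top power_less_top_ennreal)
        fix k :: nat assume k: "k > 0"
        have qr: "q \<le> r" by (rule way_below_imp_le[OF q(2)])
        obtain x y where xy: "k ^ 3 \<cdot> w \<le> (x + y) + (3 * k\<^sup>2) \<cdot> q" "x + y \<le> k ^ 3 \<cdot> q"
          "x \<le> k ^ 3 \<cdot> n \<cdot> s" "y \<le> k ^ 3 \<cdot> n \<cdot> t"
          by (rule approximate_Riesz_decomposition[OF q(1) order_trans[OF qr r']])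
        \<comment> \<open>Since the sum \<open>x + y\<close> is bounded, \<open>m r\<close> enters
          the estimate only once per copy.\<close>
        have mxy: "m x + m y \<le> of_nat (k ^ 3) * m r"
        proof -
          have "m x + m y \<le> m (k ^ 3 \<cdot> q)"
            using functional_mono[OF m xy(2)] by (simp add: functional_add[OF m])
          also have "\<dots> \<le> of_nat (k ^ 3) * m r"
            unfolding functional_nat_mult[OF m]
            by (intro mult_left_mono functional_mono[OF m qr]) simp
          finally show ?thesis .
        qed
        also have "\<dots> < \<infinity>"
          using mr by (simp add: ennreal_mult_less_top of_nat_less_top power_less_top_ennreal)
        finally have fin: "m x < \<infinity>" "m y < \<infinity>" by auto
        have "of_nat (k ^ 3) * l w \<le> l x + l y + of_nat (3 * k\<^sup>2) * l q"
          using functional_mono[OF l xy(1)]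
          by (simp add: functional_add[OF l] functional_nat_mult[OF l])
        also have "\<dots> \<le> (of_nat (k ^ 3 * n) * excess l m s + m x)
            + (of_nat (k ^ 3 * n) * excess l m t + m y) + of_nat (3 * k\<^sup>2) * l q"
          using k n xy fin by (intro add_mono le_excess order_refl) (auto simp: nat_mult_assoc)
        also have "\<dots> = of_nat (k ^ 3 * n) * ?C + (m x + m y) + of_nat (3 * k\<^sup>2) * l q"
          by (simp add: algebra_simps)
        also have "\<dots> \<le> of_nat (k ^ 3 * n) * ?C + of_nat (k ^ 3) * m r + of_nat (3 * k\<^sup>2) * l q"
          by (intro add_mono mxy order_refl)
        also have "\<dots> = of_nat (k\<^sup>2) * (of_nat k * (of_nat n * ?C + m r) + 3 * l q)"
          by (simp add: algebra_simps power2_eq_square power3_eq_cube)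
        finally have "of_nat (k\<^sup>2) * (of_nat k * l w)
            \<le> of_nat (k\<^sup>2) * (of_nat k * (of_nat n * ?C + m r) + 3 * l q)"
          by (simp add: power2_eq_square power3_eq_cube mult.assoc)
        then show "of_nat k * l w \<le> of_nat k * (of_nat n * ?C + m r) + 3 * l q"
          using k by (subst (asm) ennreal_of_nat_mult_le_cancel) auto
      qed
      then show ?thesis by simp
    next
      case False
      \<comment> \<open>If \<open>l q\<close> is infinite, O6 alone suffices: \<open>m\<close> is
        finite on both parts, so the excess term itself must be infinite.\<close>
      obtain a b where ab: "q \<le> a + b" "a \<le> n \<cdot> s" "a \<le> r" "b \<le> n \<cdot> t" "b \<le> r"
        using weak_decomposition[OF q(2) r'] by blast
      have "\<infinity> = l q"
        using False by (simp add: less_top[symmetric])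
      also have "\<dots> \<le> l a + l b"
        using functional_mono[OF l ab(1)] by (simp add: functional_add[OF l])
      also have "\<dots> \<le> (of_nat n * excess l m s + m a) + (of_nat n * excess l m t + m b)"
        using n ab finite_below by (intro add_mono le_excess) auto
      also have "\<dots> = of_nat n * ?C + (m a + m b)"
        by (simp add: algebra_simps)
      finally have "of_nat n * ?C = \<infinity>"
        using finite_below[OF ab(3)] finite_below[OF ab(5)] by (auto simp: top_unique)
      then show ?thesis by simp
    qed
  qed
  from functional_le_if_way_below[OF l this]
  show "l r \<le> of_nat n * ?C + m r" by simp
qed

lemma excess_add:
  fixes l m :: "'a \<Rightarrow> ennreal"
  assumes "is_functional l" "is_functional m"
  shows "excess l m (s + t) = excess l m s + excess l m t"
  by (rule antisym[OF excess_add_le[OF assms] excess_add_excess_le[OF assms]])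

lemma is_functional_residual:
  fixes l m :: "'a \<Rightarrow> ennreal"
  assumes "is_functional l" "is_functional m"
  shows "is_functional (residual l m)"
proof -
  have "is_functional (\<lambda>s. SUP w\<in>{w. w \<lless> s}. excess l m w)"
    by (rule is_functional_regularization[OF excess_add[OF assms] monoI[OF excess_mono]
          excess_zero[OF assms(1)]])
  then show ?thesis
    by (simp add: residual_def[abs_def])
qed

section \<open>The residuation property\<close>

lemma residual_le_excess: "residual l m (s::'a) \<le> excess l m s"
  unfolding residual_def by (rule SUP_least) (auto intro: excess_mono way_below_imp_le)

text \<open>Where \<open>m s\<close> is finite, it suffices to look way below \<open>s\<close> and
  to take the element itself, with multiplicity 1, in the formula for the excess.\<close>

lemma le_residual_add:
  fixes l m :: "'a \<Rightarrow> ennreal"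
  assumes l: "is_functional l" and m: "is_functional m"
  shows "l \<le> residual l m + m"
proof (rule le_funI)
  fix s :: 'a
  show "l s \<le> (residual l m + m) s"
  proof (cases "m s < \<infinity>")
    case True
    have "l w + 0 \<le> residual l m s + m s" if "w \<lless> s" for w
    proof -
      have w: "m w \<le> m s"
        by (rule functional_mono[OF m way_below_imp_le[OF that]])
      have "l w \<le> of_nat 1 * excess l m w + m w"
        using w True by (intro le_excess) auto
      also have "\<dots> \<le> residual l m s + m s"
        unfolding residual_def using that w by (intro add_mono) (auto intro: SUP_upper)
      finally show ?thesis by simp
    qed
    from functional_le_if_way_below[OF l this] show ?thesis by simp
  qed (simp add: less_top[symmetric])
qed

text \<open>Additivity and monotonicity of \<open>h\<close> give
  \<open>l a \<le> of_nat n * h s + m a\<close>, so \<open>h s\<close> bounds the excess. With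
  \<open>le_residual_add\<close>, the residual is the least functional \<open>h\<close> with
  \<open>l \<le> h + m\<close>.\<close>

lemma residual_le:
  fixes l m :: "'a \<Rightarrow> ennreal"
  assumes h: "is_functional h" and le: "l \<le> h + m"
  shows "residual l m \<le> h"
proof (rule le_funI)
  fix s :: 'a
  have "excess l m s \<le> h s"
  proof (rule excess_least)
    fix n a assume a: "a \<le> n \<cdot> s"
    have "l a \<le> h a + m a"
      using le_funD[OF le] by simp
    also have "\<dots> \<le> of_nat n * h s + m a"
      using functional_mono[OF h a] by (simp add: functional_nat_mult[OF h] add_right_mono)
    finally show "l a \<le> of_nat n * h s + m a" .
  qed
  with residual_le_excess show "residual l m s \<le> h s"
    by (rule order_trans)
qed

text \<open>O5 enters here: \<open>l + k \<le> j\<close> is used on an element below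
  \<open>n \<cdot> s\<close>, and \<open>m + k \<le> j\<close> on its approximate complement. The
  case \<open>k = 0\<close> identifies joins; general \<open>k\<close> gives distributivity of
  addition over them.\<close>

lemma residual_add_add_le:
  fixes l m k j :: "'a \<Rightarrow> ennreal"
  assumes l: "is_functional l" and m: "is_functional m"
    and k: "is_functional k" and j: "is_functional j"
    and le: "l + k \<le> j" "m + k \<le> j"
  shows "residual l m + m + k \<le> j"
proof (rule le_funI)
  fix s :: 'a
  show "(residual l m + m + k) s \<le> j s"
  proof (cases "m s < \<infinity> \<and> k s < \<infinity>")
    case False
    have "m s + k s \<le> j s"
      using le_funD[OF le(2)] by simp
    with False have "j s = \<infinity>"
      by (auto simp: less_top[symmetric] top_unique)
    then show ?thesis by simp
  next
    case True
    have "excess l m s \<le> j s - (m s + k s)"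
    proof (rule excess_least)
      fix n a assume n: "n > 0" and a: "a \<le> n \<cdot> s" "m a < \<infinity>"
      let ?n = "of_nat n :: ennreal"
      have ka: "k a < \<infinity>"
        using functional_mono[OF k a(1)] True
        by (auto simp: functional_nat_mult[OF k] ennreal_mult_less_top of_nat_less_top intro: order.strict_trans1)
      \<comment> \<open>This is the desired bound with the subtraction cleared and \<open>k\<close>
        of the element added on both sides; the finite value \<open>k a\<close> is cancelled
        afterwards.\<close>
      have "(l + k) w + ?n * (m s + k s) \<le> ?n * j s + (m a + k a)" if "w \<lless> a" for w
      proof -
        obtain r where r: "w + r \<le> n \<cdot> s" "n \<cdot> s \<le> a + r"
          by (rule complementE[OF \<open>w \<lless> a\<close> a(1)])
        have "?n * m s \<le> m a + m r" "?n * k s \<le> k a + k r"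
          using functional_mono[OF m r(2)] functional_mono[OF k r(2)]
          by (simp_all add: functional_add[OF m] functional_nat_mult[OF m]
              functional_add[OF k] functional_nat_mult[OF k])
        then have "(l + k) w + ?n * (m s + k s) \<le> (l + k) w + ((m a + m r) + (k a + k r))"
          by (intro add_left_mono) (simp add: distrib_left add_mono)
        also have "\<dots> = ((l + k) w + (m + k) r) + (m a + k a)"
          by (simp add: ac_simps)
        also have "\<dots> \<le> (j w + j r) + (m a + k a)"
          by (intro add_right_mono add_mono le_funD[OF le(1)] le_funD[OF le(2)])
        also have "j w + j r \<le> ?n * j s"
          using functional_mono[OF j r(1)]
          by (simp add: functional_add[OF j] functional_nat_mult[OF j])
        finally show ?thesis by (simp add: add_right_mono)
      qed
      from functional_le_if_way_below[OF is_functional_add[OF l k] this]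
      have "k a + (l a + ?n * (m s + k s)) \<le> k a + (?n * j s + m a)"
        by (simp add: ac_simps)
      then have *: "l a + ?n * (m s + k s) \<le> ?n * j s + m a"
        using ka by auto
      have jms: "m s + k s \<le> j s"
        using le_funD[OF le(2)] by simp
      have "?n * (m s + k s) + l a \<le> ?n * ((j s - (m s + k s)) + (m s + k s)) + m a"
        unfolding diff_add_cancel_ennreal[OF jms] using * by (simp only: ac_simps)
      also have "\<dots> = ?n * (m s + k s) + (?n * (j s - (m s + k s)) + m a)"
        by (simp only: distrib_left ac_simps)
      finally show "l a \<le> ?n * (j s - (m s + k s)) + m a"
        using True by (simp add: ennreal_add_left_cancel_le ennreal_mult_eq_top_iff less_top[symmetric])
    qed
    then have "residual l m s \<le> j s - (m s + k s)"
      by (rule order_trans[OF residual_le_excess])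
    then have "residual l m s + (m s + k s) \<le> (j s - (m s + k s)) + (m s + k s)"
      by (rule add_right_mono)
    also have "\<dots> = j s"
      using le_funD[OF le(2), of s] by (intro diff_add_cancel_ennreal) simp
    finally show ?thesis by (simp add: add.assoc)
  qed
qed

end

subsection \<open>The lattice of functionals\<close>

interpretation functionals: partial_order functionals
  by unfold_locales (auto simp: functionals_def)

lemma carrier_functionals [simp]: "l \<in> carrier functionals \<longleftrightarrow> is_functional l"
  by (simp add: functionals_def)

lemma le_functionals [simp]: "l \<sqsubseteq>\<^bsub>functionals\<^esub> m \<longleftrightarrow> l \<le> m"
  by (simp add: functionals_def)

section \<open>Existence of suprema and infima\<close>

context Cu_semigroup
begin

text \<open>Induction from the zero functional: if \<open>j\<close> is the least upper bound so far,
  \<open>residual m j + j\<close> is the least upper bound after adjoining \<open>m\<close>.\<close>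

lemma finite_functionals_lub:
  fixes X :: "('a \<Rightarrow> ennreal) set"
  assumes "finite X" "\<And>l. l \<in> X \<Longrightarrow> is_functional l"
  shows "\<exists>j. is_functional j \<and> (\<forall>l\<in>X. l \<le> j) \<and> (\<forall>k. is_functional k \<longrightarrow> (\<forall>l\<in>X. l \<le> k) \<longrightarrow> j \<le> k)"
  using assms
proof (induction X rule: finite_induct)
  case empty
  then show ?case
    using is_functional_0 by (auto simp: le_fun_def)
next
  case (insert m X)
  then obtain j where j: "is_functional j" "\<And>l. l \<in> X \<Longrightarrow> l \<le> j"
    and least: "\<And>k. is_functional k \<Longrightarrow> \<forall>l\<in>X. l \<le> k \<Longrightarrow> j \<le> k"
    by blast
  have m: "is_functional m" using insert.prems by simp
  show ?case
  proof (intro exI[of _ "residual m j + j"] conjI ballI allI impI)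
    show "is_functional (residual m j + j)"
      using m j by (intro is_functional_add is_functional_residual)
    fix l assume "l \<in> insert m X"
    moreover have "j \<le> residual m j + j" by (simp add: le_fun_def)
    ultimately show "l \<le> residual m j + j"
      using le_residual_add[OF m j(1)] j(2) by (auto intro: order_trans)
  next
    fix k assume k: "is_functional k" "\<forall>l\<in>insert m X. l \<le> k"
    then have "residual m j + j + 0 \<le> k"
      using m j least by (intro residual_add_add_le is_functional_0) auto
    then show "residual m j + j \<le> k" by simp
  qed
qed

text \<open>The least upper bounds of the finite subsets form a directed family, by taking unions,
  so their pointwise supremum is again a functional.\<close>

lemma functionals_lub_exists:
  fixes A :: "('a \<Rightarrow> ennreal) set"
  assumes A: "\<And>l. l \<in> A \<Longrightarrow> is_functional l"
  obtains j where "is_functional j" "\<And>l. l \<in> A \<Longrightarrow> l \<le> j"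
    "\<And>k. is_functional k \<Longrightarrow> (\<And>l. l \<in> A \<Longrightarrow> l \<le> k) \<Longrightarrow> j \<le> k"
proof -
  define I where "I = {X. finite X \<and> X \<subseteq> A}"
  have "\<forall>X\<in>I. \<exists>j. is_functional j \<and> (\<forall>l\<in>X. l \<le> j) \<and>
      (\<forall>k. is_functional k \<longrightarrow> (\<forall>l\<in>X. l \<le> k) \<longrightarrow> j \<le> k)"
    unfolding I_def using A by (intro ballI finite_functionals_lub) auto
  from bchoice[OF this] obtain f where f: "\<And>X. X \<in> I \<Longrightarrow> is_functional (f X)"
    "\<And>X l. X \<in> I \<Longrightarrow> l \<in> X \<Longrightarrow> l \<le> f X"
    "\<And>X k. X \<in> I \<Longrightarrow> is_functional k \<Longrightarrow> \<forall>l\<in>X. l \<le> k \<Longrightarrow> f X \<le> k"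
    by blast
  show thesis
  proof (rule that)
    show "is_functional (\<lambda>s. SUP X\<in>I. f X s)"
    proof (rule is_functional_directed_SUP)
      show "I \<noteq> {}" by (auto simp: I_def)
      fix X Y assume XY: "X \<in> I" "Y \<in> I"
      then have U: "X \<union> Y \<in> I" by (auto simp: I_def)
      then have "f X \<le> f (X \<union> Y)" "f Y \<le> f (X \<union> Y)"
        using XY f by (auto intro!: f(3))
      with U show "\<exists>Z\<in>I. f X \<le> f Z \<and> f Y \<le> f Z" by blast
    qed (rule f)
    show "l \<le> (\<lambda>s. SUP X\<in>I. f X s)" if "l \<in> A" for l
    proof (rule le_funI)
      fix s
      have l: "{l} \<in> I" using that by (simp add: I_def)
      then have "l s \<le> f {l} s" by (intro le_funD[OF f(2)]) auto
      also have "\<dots> \<le> (SUP X\<in>I. f X s)" by (rule SUP_upper[OF l])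
      finally show "l s \<le> (SUP X\<in>I. f X s)" .
    qed
    show "(\<lambda>s. SUP X\<in>I. f X s) \<le> k" if "is_functional k" "\<And>l. l \<in> A \<Longrightarrow> l \<le> k" for k
      using that by (intro le_funI SUP_least le_funD[OF f(3)]) (auto simp: I_def)
  qed
qed

lemma complete_lattice_functionals: "complete_lattice (functionals :: ('a \<Rightarrow> ennreal) gorder)"
proof (rule functionals.complete_latticeI)
  fix A :: "('a \<Rightarrow> ennreal) set"
  assume "A \<subseteq> carrier functionals"
  then have A: "is_functional l" if "l \<in> A" for l
    using that by auto
  obtain j where "is_functional j" "\<And>l. l \<in> A \<Longrightarrow> l \<le> j"
    "\<And>k. is_functional k \<Longrightarrow> (\<And>l. l \<in> A \<Longrightarrow> l \<le> k) \<Longrightarrow> j \<le> k"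
    using functionals_lub_exists[of A] A by blast
  then show "\<exists>j. is_lub functionals j A"
    using A by (intro exI[of _ j]) (auto simp: least_def Upper_def)
  \<comment> \<open>The infimum is obtained as the supremum of all functionals that are lower
    bounds.\<close>
  let ?B = "{k. is_functional k \<and> (\<forall>l\<in>A. k \<le> l)}"
  obtain i where i: "is_functional i" "\<And>l. l \<in> ?B \<Longrightarrow> l \<le> i"
    "\<And>k. is_functional k \<Longrightarrow> (\<And>l. l \<in> ?B \<Longrightarrow> l \<le> k) \<Longrightarrow> i \<le> k"
    using functionals_lub_exists[of ?B] by blast
  then have "i \<le> l" if "l \<in> A" for l
    using A that by blast
  with i show "\<exists>i. is_glb functionals i A"
    using A by (intro exI[of _ i]) (auto simp: greatest_def Lower_def)
qed

sublocale functionals: complete_lattice "functionals :: ('a \<Rightarrow> ennreal) gorder"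
  by (rule complete_lattice_functionals)

abbreviation fun_join :: "('a \<Rightarrow> ennreal) \<Rightarrow> ('a \<Rightarrow> ennreal) \<Rightarrow> 'a \<Rightarrow> ennreal"  (infixl \<open>\<curlyvee>\<close> 65)
  where "l \<curlyvee> m \<equiv> l \<squnion>\<^bsub>functionals\<^esub> m"

abbreviation fun_meet :: "('a \<Rightarrow> ennreal) \<Rightarrow> ('a \<Rightarrow> ennreal) \<Rightarrow> 'a \<Rightarrow> ennreal"  (infixl \<open>\<curlywedge>\<close> 70)
  where "l \<curlywedge> m \<equiv> l \<sqinter>\<^bsub>functionals\<^esub> m"

lemma is_functional_join: "is_functional l \<Longrightarrow> is_functional m \<Longrightarrow> is_functional (l \<curlyvee> m)"
  using functionals.join_closed[of l m] by simp

lemma is_functional_meet: "is_functional l \<Longrightarrow> is_functional m \<Longrightarrow> is_functional (l \<curlywedge> m)"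
  using functionals.meet_closed[of l m] by simp

lemma join_upper:
  assumes "is_functional l" "is_functional m"
  shows "l \<le> l \<curlyvee> m" "m \<le> l \<curlyvee> m"
  using functionals.join_left[of l m] functionals.join_right[of l m] assms by simp_all

lemma join_least:
  "l \<le> k \<Longrightarrow> m \<le> k \<Longrightarrow> is_functional l \<Longrightarrow> is_functional m \<Longrightarrow> is_functional k \<Longrightarrow> l \<curlyvee> m \<le> k"
  using functionals.join_le[of l k m] by simp

lemma meet_lower:
  assumes "is_functional l" "is_functional m"
  shows "l \<curlywedge> m \<le> l" "l \<curlywedge> m \<le> m"
  using functionals.meet_left[of l m] functionals.meet_right[of l m] assms by simp_all

lemma meet_greatest:
  "k \<le> l \<Longrightarrow> k \<le> m \<Longrightarrow> is_functional l \<Longrightarrow> is_functional m \<Longrightarrow> is_functional k \<Longrightarrow> k \<le> l \<curlywedge> m"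
  using functionals.meet_le[of k l m] by simp

section \<open>Distributive laws\<close>

lemmas functional_closure =
  is_functional_join is_functional_meet is_functional_add is_functional_residual

lemma join_eq_residual_add:
  assumes l: "is_functional l" and m: "is_functional m"
  shows "l \<curlyvee> m = residual l m + m"
proof (rule antisym)
  show "l \<curlyvee> m \<le> residual l m + m"
    using l m by (intro join_least le_residual_add functional_closure) (auto simp: le_fun_def)
  have "residual l m + m + 0 \<le> l \<curlyvee> m"
    using l m by (intro residual_add_add_le is_functional_0 functional_closure) (auto simp: join_upper)
  then show "residual l m + m \<le> l \<curlyvee> m" by simp
qed

text \<open>The nontrivial inequality is \<open>residual_add_add_le\<close> with the right-hand side
  as \<open>j\<close>.\<close>

lemma join_add_distrib:
  assumes l: "is_functional l" and m: "is_functional m" and k: "is_functional k"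
  shows "(l \<curlyvee> m) + k = (l + k) \<curlyvee> (m + k)"
proof (rule antisym)
  show "(l \<curlyvee> m) + k \<le> (l + k) \<curlyvee> (m + k)"
    unfolding join_eq_residual_add[OF l m]
    using assms by (intro residual_add_add_le functional_closure join_upper)
  show "(l + k) \<curlyvee> (m + k) \<le> (l \<curlyvee> m) + k"
    using assms by (intro join_least add_right_mono join_upper functional_closure)
qed

text \<open>By \<open>residual_le\<close>, adding \<open>k\<close> is right adjoint to \<open>\<lambda>h. residual h k\<close>, hence preserves meets.\<close>

lemma meet_add_distrib:
  assumes l: "is_functional l" and m: "is_functional m" and k: "is_functional k"
  shows "(l \<curlywedge> m) + k = (l + k) \<curlywedge> (m + k)"
proof (rule antisym)
  show "(l \<curlywedge> m) + k \<le> (l + k) \<curlywedge> (m + k)"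
    using assms by (intro meet_greatest add_right_mono meet_lower functional_closure)
  let ?h = "(l + k) \<curlywedge> (m + k)"
  have h: "is_functional ?h" using assms by (intro functional_closure)
  have "residual ?h k \<le> l" "residual ?h k \<le> m"
    using assms by (auto intro!: residual_le meet_lower functional_closure)
  then have "residual ?h k \<le> l \<curlywedge> m"
    using assms h by (intro meet_greatest functional_closure)
  then have "residual ?h k + k \<le> (l \<curlywedge> m) + k"
    by (rule add_right_mono)
  with le_residual_add[OF h k] show "?h \<le> (l \<curlywedge> m) + k"
    by (rule order_trans)
qed

text \<open>\<open>residual l m\<close> already satisfies the inequality whose least solution is
  \<open>residual l m'\<close>.\<close>

lemma residual_antimono:
  fixes l m m' :: "'a \<Rightarrow> ennreal"
  assumes l: "is_functional l" and m: "is_functional m" "is_functional m'" and "m \<le> m'"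
  shows "residual l m' \<le> residual l m"
proof (rule residual_le)
  show "l \<le> residual l m + m'"
    using le_residual_add[OF l m(1)] add_left_mono[OF \<open>m \<le> m'\<close>] by (rule order_trans)
qed (rule is_functional_residual[OF l m(1)])

lemma join_meet_distrib:
  assumes x: "is_functional x" and y: "is_functional y" and z: "is_functional z"
  shows "x \<curlyvee> (y \<curlywedge> z) = (x \<curlyvee> y) \<curlywedge> (x \<curlyvee> z)"
proof (rule antisym)
  have yz: "is_functional (y \<curlywedge> z)" using assms by (intro functional_closure)
  show "x \<curlyvee> (y \<curlywedge> z) \<le> (x \<curlyvee> y) \<curlywedge> (x \<curlyvee> z)"
    using assms yz
    by (intro join_least meet_greatest join_upper functional_closure
        order_trans[OF meet_lower(1) join_upper(2)] order_trans[OF meet_lower(2) join_upper(2)])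
  let ?r = "residual x (y \<curlywedge> z)"
  have r: "is_functional ?r" using x yz by (rule is_functional_residual)
  \<comment> \<open>One residual \<open>?r\<close> serves for both \<open>y\<close> and
    \<open>z\<close>, because the residual grows when its second argument shrinks to their
    meet.\<close>
  have le: "x \<curlyvee> w \<le> w + ?r" if w: "is_functional w" "y \<curlywedge> z \<le> w" for w
    unfolding join_eq_residual_add[OF x w(1)] add.commute[of _ w]
    by (intro add_left_mono residual_antimono x w yz)
  have "(x \<curlyvee> y) \<curlywedge> (x \<curlyvee> z) \<le> (y + ?r) \<curlywedge> (z + ?r)"
    using assms r yz
    by (intro meet_greatest functional_closure order_trans[OF meet_lower(1) le]
        order_trans[OF meet_lower(2) le] meet_lower)
  also have "\<dots> = x \<curlyvee> (y \<curlywedge> z)"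
    unfolding join_eq_residual_add[OF x yz] meet_add_distrib[OF y z r, symmetric]
    by (rule add.commute)
  finally show "(x \<curlyvee> y) \<curlywedge> (x \<curlyvee> z) \<le> x \<curlyvee> (y \<curlywedge> z)" .
qed

text \<open>The usual lattice argument deriving one distributive law from the other: expand the join
  of \<open>x \<curlywedge> y\<close> and \<open>x \<curlywedge> z\<close> as a meet and bound the
  left-hand side by both factors.\<close>

lemma meet_join_distrib:
  assumes x: "is_functional x" and y: "is_functional y" and z: "is_functional z"
  shows "x \<curlywedge> (y \<curlyvee> z) = (x \<curlywedge> y) \<curlyvee> (x \<curlywedge> z)"
proof (rule antisym)
  have xy: "is_functional (x \<curlywedge> y)" using x y by (intro functional_closure)
  show "(x \<curlywedge> y) \<curlyvee> (x \<curlywedge> z) \<le> x \<curlywedge> (y \<curlyvee> z)"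
    using assms
    by (intro join_least meet_greatest meet_lower functional_closure
        order_trans[OF meet_lower(2) join_upper(1)] order_trans[OF meet_lower(2) join_upper(2)])
  let ?w = "x \<curlywedge> (y \<curlyvee> z)"
  have w: "is_functional ?w" using assms by (intro functional_closure)
  have "?w \<le> ((x \<curlywedge> y) \<curlyvee> x) \<curlywedge> ((x \<curlywedge> y) \<curlyvee> z)"
  proof (intro meet_greatest)
    show "?w \<le> (x \<curlywedge> y) \<curlyvee> x"
      using assms by (intro order_trans[OF meet_lower(1) join_upper(2)] functional_closure)
    have "?w \<le> (z \<curlyvee> x) \<curlywedge> (z \<curlyvee> y)"
      using assms w
      by (intro meet_greatest functional_closure order_trans[OF meet_lower(1) join_upper(2)]
          order_trans[OF meet_lower(2) join_least] join_upper)
    also have "\<dots> = z \<curlyvee> (x \<curlywedge> y)"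
      using assms by (simp add: join_meet_distrib)
    also have "\<dots> = (x \<curlywedge> y) \<curlyvee> z"
      by (rule join_comm)
    finally show "?w \<le> (x \<curlywedge> y) \<curlyvee> z" .
  qed (use assms in \<open>auto intro: functional_closure\<close>)
  also have "\<dots> = (x \<curlywedge> y) \<curlyvee> (x \<curlywedge> z)"
    using join_meet_distrib[OF xy x z] by simp
  finally show "?w \<le> (x \<curlywedge> y) \<curlyvee> (x \<curlywedge> z)" .
qed

end

theorem theorem4p1p2:
  assumes "axiom_O1 TYPE('a::ordered_semigroup)"
    and "axiom_O2 TYPE('a)"
    and "axiom_O3 TYPE('a)"
    and "axiom_O4 TYPE('a)"
    and "axiom_O5 TYPE('a)"
    and "axiom_O6 TYPE('a)"
  defines "F \<equiv> (functionals :: ('a \<Rightarrow> ennreal) gorder)"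
  shows "complete_lattice F \<and> distributive_ops F \<and>
    (\<forall>l1\<in>carrier F. \<forall>l2\<in>carrier F. \<forall>l3\<in>carrier F.
       (l1 \<squnion>\<^bsub>F\<^esub> l2) + l3 = (l1 + l3) \<squnion>\<^bsub>F\<^esub> (l2 + l3) \<and>
       (l1 \<sqinter>\<^bsub>F\<^esub> l2) + l3 = (l1 + l3) \<sqinter>\<^bsub>F\<^esub> (l2 + l3))"
proof -
  interpret Cu_semigroup "TYPE('a)"
    using assms(2-6) by unfold_locales
  show ?thesis
    unfolding F_def distributive_ops_def
    by (simp add: complete_lattice_functionals meet_join_distrib join_meet_distrib
        join_add_distrib meet_add_distrib)
qed

end
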